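(* Let $G$ be a connected graph with $|V(G)|\ge 2$ and let $F$ be a graph with $|V(F)|\ge 2$. Then the lexicographic product $G[F]$ is well $\gamma_t$-dominated if and only if one of the following holds: (i) $G$ is complete and $F$ is well $\gamma_t$-dominated with $\gamma_t(F)=2$; (ii) $G$ is well $\gamma_t$-dominated and $\delta(F)=0$.
   Context: All graphs are finite, simple and undirected; $\delta(H)$ is the minimum degree. The lexicographic product $G[F]$ has vertex set $V(G)\times V(F)$, with $(g,f)$ adjacent to $(g',f')$ iff $gg'\in E(G)$, or $g=g'$ and $ff'\in E(F)$. A total dominating set of $H$ is a set $S$ such that every vertex of $H$ has a neighbor in $S$; it is minimal if no proper subset is total dominating. $\gamma_t(H)$ is the minimum and $\Gamma_t(H)$ the maximum cardinality of a minimal total dominating set; $H$ is well $\gamma_t$-dominated if $\gamma_t(H)=\Gamma_t(H)$. *)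

theory Defs
  imports "Graph_Theory.Graph_Theory"
begin

text \<open>
  A finite simple undirected graph is a \<^locale>\<open>pair_graph\<close>: a finite vertex set with a symmetric,
  irreflexive set of ordered pairs, each edge occurring in both orientations.
\<close>

definition lex_product :: "'a pair_pre_digraph \<Rightarrow> 'b pair_pre_digraph \<Rightarrow> ('a \<times> 'b) pair_pre_digraph"
  where "lex_product G F =
    \<lparr> pverts = pverts G \<times> pverts F,
      parcs = {((g, f), (g', f')) | g f g' f'.
        (g, f) \<in> pverts G \<times> pverts F \<and> (g', f') \<in> pverts G \<times> pverts F \<and>
        ((g, g') \<in> parcs G \<or> g = g' \<and> (f, f') \<in> parcs F)} \<rparr>"

lemma pair_graph_lex_product:
  assumes "pair_graph G" and "pair_graph F"
  shows "pair_graph (lex_product G F)"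
proof -
  interpret G: pair_graph G by fact
  interpret F: pair_graph F by fact
  let ?H = "lex_product G F"
  have "parcs ?H \<subseteq> pverts ?H \<times> pverts ?H" and fin: "finite (pverts ?H)"
    by (auto simp: lex_product_def)
  then have "finite (parcs ?H)"
    by (meson finite_SigmaI finite_subset)
  with fin show ?thesis
    by unfold_locales
      (auto simp: lex_product_def symmetric_def
        intro!: symI dest: symD[OF G.sym_arcs[unfolded symmetric_def, simplified]]
          symD[OF F.sym_arcs[unfolded symmetric_def, simplified]] G.no_loops' F.no_loops')
qed

text \<open>In a \<^locale>\<open>pair_graph\<close> the out-degree of a vertex is its number of neighbours.\<close>

definition min_degree :: "'a pair_pre_digraph \<Rightarrow> nat"
  where "min_degree H = Min (out_degree H ` pverts H)"

definition total_dominating_set :: "'a pair_pre_digraph \<Rightarrow> 'a set \<Rightarrow> bool"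
  where "total_dominating_set H S \<longleftrightarrow>
    S \<subseteq> pverts H \<and> (\<forall>v\<in>pverts H. \<exists>u\<in>S. (v, u) \<in> parcs H)"

definition minimal_total_dominating_set :: "'a pair_pre_digraph \<Rightarrow> 'a set \<Rightarrow> bool"
  where "minimal_total_dominating_set H S \<longleftrightarrow>
    total_dominating_set H S \<and> (\<forall>T. T \<subset> S \<longrightarrow> \<not> total_dominating_set H T)"

definition gamma_t :: "'a pair_pre_digraph \<Rightarrow> nat"
  where "gamma_t H = Min (card ` {S. minimal_total_dominating_set H S})"

definition Gamma_t :: "'a pair_pre_digraph \<Rightarrow> nat"
  where "Gamma_t H = Max (card ` {S. minimal_total_dominating_set H S})"

text \<open>
  A graph with an isolated vertex has no total dominating set, so both numbers are undefined for it
  (here: the unspecified values of \<^const>\<open>Min\<close> and \<^const>\<open>Max\<close> on the empty set). Such a graph is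
  not well dominated; the first conjunct says so.
\<close>

definition well_gamma_t_dominated :: "'a pair_pre_digraph \<Rightarrow> bool"
  where "well_gamma_t_dominated H \<longleftrightarrow>
    (\<exists>S. total_dominating_set H S) \<and> gamma_t H = Gamma_t H"

end

theory Submission
  imports Defs
begin

text \<open>
  Every minimal total dominating set \<open>S\<close> of \<open>G\<close> gives the minimal total dominating set
  \<open>S \<times> {f}\<close> of \<open>G[F]\<close>. If \<open>F\<close> has no isolated vertex, then \<open>A \<times> D\<close> is another one, for every
  maximal independent set \<open>A\<close> of \<open>G\<close> and every minimal total dominating set \<open>D\<close> of \<open>F\<close>. But
  adding to \<open>A\<close> one neighbour of each of its vertices yields a total dominating set of \<open>G\<close> with at
  most \<open>2 |A|\<close> elements, and with at most \<open>2 |A| - 1\<close> elements if two vertices of \<open>A\<close> have a common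
  neighbour. If all minimal total dominating sets of \<open>G[F]\<close> have the same cardinality, this forces
  \<open>|D| = 2\<close> and rules out an induced path on three vertices in \<open>G\<close>, so \<open>G\<close> is complete.
  Conversely, if \<open>F\<close> has an isolated vertex, the projection to \<open>G\<close> is injective on each minimal total
  dominating set of \<open>G[F]\<close> and its image is a minimal total dominating set of \<open>G\<close>; if \<open>G\<close> is complete,
  any two vertices in different fibres already form a total dominating set.
\<close>

section \<open>Minimal total dominating sets\<close>

text \<open>A superset of a total dominating set inside \<open>pverts H\<close> is again one, so
  minimality can be tested by deleting single elements. Deleting \<open>u\<close> fails exactly when
  some vertex is dominated by \<open>u\<close> alone. Later minimality proofs exhibit such a private
  witness for each element.\<close>

lemma minimal_total_dominating_set_iff_private:
  "minimal_total_dominating_set H S \<longleftrightarrow> total_dominating_set H S \<and>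
    (\<forall>u\<in>S. \<exists>v\<in>pverts H. \<forall>w\<in>S. (v, w) \<in> parcs H \<longrightarrow> w = u)"
    (is "_ \<longleftrightarrow> ?R")
proof
  assume m: "minimal_total_dominating_set H S"
  then have t: "total_dominating_set H S"
    by (simp add: minimal_total_dominating_set_def)
  have "\<exists>v\<in>pverts H. \<forall>w\<in>S. (v, w) \<in> parcs H \<longrightarrow> w = u" if "u \<in> S" for u
  proof -
    from that have "S - {u} \<subset> S" by blast
    with m have "\<not> total_dominating_set H (S - {u})"
      by (simp add: minimal_total_dominating_set_def)
    with t show ?thesis
      unfolding total_dominating_set_def by blast
  qed
  with t show ?R by blast
next
  assume R: ?R
  have "\<not> total_dominating_set H T" if T: "T \<subset> S" for T
  proof -
    from T obtain u where u: "u \<in> S" "u \<notin> T" by blast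
    with R obtain v where "v \<in> pverts H" "\<forall>w\<in>S. (v, w) \<in> parcs H \<longrightarrow> w = u" by blast
    with u T show ?thesis unfolding total_dominating_set_def by blast
  qed
  with R show "minimal_total_dominating_set H S"
    by (simp add: minimal_total_dominating_set_def)
qed

lemma minimal_total_dominating_set_eqI:
  assumes "minimal_total_dominating_set H S" "T \<subseteq> S" "total_dominating_set H T"
  shows "T = S"
  using assms by (auto simp: minimal_total_dominating_set_def)

lemma ex_minimal_total_dominating_subset:
  assumes "finite S" "total_dominating_set H S"
  shows "\<exists>T\<subseteq>S. minimal_total_dominating_set H T"
  using assms
proof (induction rule: finite_psubset_induct)
  case (psubset S)
  show ?case
  proof (cases "\<exists>T. T \<subset> S \<and> total_dominating_set H T")
    case True
    with psubset.IH show ?thesis by (meson order_trans psubset_imp_subset)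
  next
    case False
    with psubset.prems show ?thesis by (auto simp: minimal_total_dominating_set_def)
  qed
qed

lemma finite_minimal_total_dominating_sets:
  assumes "finite (pverts H)"
  shows "finite {S. minimal_total_dominating_set H S}"
  using assms
  by (auto intro: finite_subset[of _ "Pow (pverts H)"]
      simp: minimal_total_dominating_set_def total_dominating_set_def)

text \<open>Eliminates \<open>Min\<close> and \<open>Max\<close>. In a finite graph every total
  dominating set shrinks to a minimal one, so the existence conjunct also makes both extrema range
  over a nonempty finite set.\<close>

lemma well_gamma_t_dominated_iff:
  assumes fin: "finite (pverts H)"
  shows "well_gamma_t_dominated H \<longleftrightarrow> (\<exists>S. minimal_total_dominating_set H S) \<and>
    (\<forall>S T. minimal_total_dominating_set H S \<longrightarrow> minimal_total_dominating_set H T \<longrightarrow>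
      card S = card T)"
proof -
  let ?M = "{S. minimal_total_dominating_set H S}"
  have finM: "finite (card ` ?M)"
    using finite_minimal_total_dominating_sets[OF fin] by simp
  have ex: "(\<exists>S. total_dominating_set H S) \<longleftrightarrow> (\<exists>S. minimal_total_dominating_set H S)"
    using ex_minimal_total_dominating_subset fin
    by (meson finite_subset minimal_total_dominating_set_def total_dominating_set_def)
  have "Min (card ` ?M) = Max (card ` ?M) \<longleftrightarrow> (\<forall>S\<in>?M. \<forall>T\<in>?M. card S = card T)"
    if "?M \<noteq> {}"
  proof
    assume eq: "Min (card ` ?M) = Max (card ` ?M)"
    have "card S = Max (card ` ?M)" if "S \<in> ?M" for S
      using Min_le[OF finM imageI[OF that]] Max_ge[OF finM imageI[OF that]] eq by linarith
    then show "\<forall>S\<in>?M. \<forall>T\<in>?M. card S = card T" by metis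
  next
    assume "\<forall>S\<in>?M. \<forall>T\<in>?M. card S = card T"
    moreover have "Min (card ` ?M) \<in> card ` ?M" "Max (card ` ?M) \<in> card ` ?M"
      using finM that by (auto intro!: Min_in Max_in simp del: mem_Collect_eq)
    ultimately show "Min (card ` ?M) = Max (card ` ?M)" by (metis imageE)
  qed
  with ex show ?thesis
    unfolding well_gamma_t_dominated_def gamma_t_def Gamma_t_def by blast
qed

lemma well_gamma_t_dominated_card:
  assumes fin: "finite (pverts H)" and "well_gamma_t_dominated H"
    and "minimal_total_dominating_set H S"
  shows "card S = gamma_t H"
proof -
  have "card ` {S. minimal_total_dominating_set H S} = {card S}"
    using assms(2,3) unfolding well_gamma_t_dominated_iff[OF fin] by blast
  then show ?thesis by (simp add: gamma_t_def)
qed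

section \<open>Isolated vertices, connectedness and maximal independent sets\<close>

lemma min_degree_eq_0_iff:
  assumes "pair_graph H" and "pverts H \<noteq> {}"
  shows "min_degree H = 0 \<longleftrightarrow> (\<exists>v\<in>pverts H. \<forall>u. (v, u) \<notin> parcs H)"
proof -
  interpret pair_graph H by fact
  have deg: "out_degree H v = 0 \<longleftrightarrow> (\<forall>u. (v, u) \<notin> parcs H)" for v
    using finite_out_arcs[of v] by (auto simp: out_degree_def out_arcs_def)
  let ?D = "out_degree H ` pverts H"
  have "finite ?D" "?D \<noteq> {}" using assms(2) pair_finite_verts by auto
  then have "Min ?D = 0 \<longleftrightarrow> 0 \<in> ?D"
    by (metis Min_in Min_le le_zero_eq)
  then have "min_degree H = 0 \<longleftrightarrow> (\<exists>v\<in>pverts H. out_degree H v = 0)"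
    by (auto simp: min_degree_def image_iff)
  then show ?thesis by (simp add: deg)
qed

lemma connected_imp_rtrancl:
  assumes "pair_graph G" "Digraph_Component.connected G" "u \<in> pverts G" "v \<in> pverts G"
  shows "(u, v) \<in> (parcs G)\<^sup>*"
proof -
  interpret pair_graph G by fact
  have "u \<rightarrow>\<^sup>*\<^bsub>mk_symmetric G\<^esub> v"
    using assms by (auto simp: connected_def strongly_connected_def)
  \<comment> \<open>The arcs are already symmetric, so passing to the symmetric closure adds
    nothing.\<close>
  then have "u \<rightarrow>\<^sup>*\<^bsub>G\<^esub> v"
    using reachable_mk_symmetric_eq[OF sym_arcs] by simp
  then show ?thesis
    using reachable_rtranclI by fastforce
qed

lemma connected_imp_neighbour:
  assumes "pair_graph G" "Digraph_Component.connected G" "card (pverts G) \<ge> 2" "v \<in> pverts G"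
  obtains u where "(v, u) \<in> parcs G"
proof -
  obtain w where "w \<in> pverts G" "w \<noteq> v"
    using assms(3,4) card_mono[of "{v}" "pverts G"] by fastforce
  with connected_imp_rtrancl[OF assms(1,2) assms(4)] have "(v, w) \<in> (parcs G)\<^sup>*" "v \<noteq> w" by auto
  then show ?thesis using that by (meson converse_rtranclE)
qed

text \<open>Without an induced path on three vertices, the relation "equal or adjacent" is
  transitive. It then absorbs reachability, and connectedness makes any two distinct vertices
  adjacent.\<close>

lemma connected_not_complete_imp_induced_path:
  assumes "pair_graph G" "Digraph_Component.connected G"
    and nc: "\<not> complete_digraph (card (pverts G)) G"
  obtains u v w where "(u, v) \<in> parcs G" "(v, w) \<in> parcs G" "u \<noteq> w" "(u, w) \<notin> parcs G"
proof (rule ccontr)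
  interpret pair_graph G by fact
  assume "\<not> thesis"
  with that have tr: "u = w \<or> (u, w) \<in> parcs G"
    if "(u, v) \<in> parcs G" "(v, w) \<in> parcs G" for u v w
    using that by blast
  have "u = w \<or> (u, w) \<in> parcs G" if "(u, w) \<in> (parcs G)\<^sup>*" for u w
    using that by induction (auto dest: tr)
  then have "parcs G = {(u, v). (u, v) \<in> pverts G \<times> pverts G \<and> u \<noteq> v}"
    using connected_imp_rtrancl[OF assms(1,2)] by (auto dest: in_arcsD1 in_arcsD2 no_loops')
  with nc pair_finite_verts show False by (simp add: complete_digraph_pair_def)
qed

text \<open>Maximality is encoded as domination of the outside vertices: in a loop-free symmetric
  graph, a vertex outside \<open>A\<close> without a neighbour in \<open>A\<close> could be added to
  \<open>A\<close>. This is the form that the domination arguments consume.\<close>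

definition maximal_independent_set :: "'a pair_pre_digraph \<Rightarrow> 'a set \<Rightarrow> bool"
  where "maximal_independent_set G A \<longleftrightarrow> A \<subseteq> pverts G \<and>
    (\<forall>a\<in>A. \<forall>b\<in>A. (a, b) \<notin> parcs G) \<and> (\<forall>v\<in>pverts G - A. \<exists>a\<in>A. (v, a) \<in> parcs G)"

text \<open>The prescribed subset \<open>B\<close> serves to place both ends of an induced path into
  one maximal independent set.\<close>

lemma ex_maximal_independent_superset:
  assumes "pair_graph G" "B \<subseteq> pverts G" "\<forall>a\<in>B. \<forall>b\<in>B. (a, b) \<notin> parcs G"
  obtains A where "B \<subseteq> A" "maximal_independent_set G A"
proof -
  interpret pair_graph G by fact
  let ?I = "{A. A \<subseteq> pverts G \<and> (\<forall>a\<in>A. \<forall>b\<in>A. (a, b) \<notin> parcs G)}"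
  have "finite ?I"
    using pair_finite_verts by (auto intro: finite_subset[of _ "Pow (pverts G)"])
  with assms obtain A where A: "A \<in> ?I" "B \<subseteq> A" and max: "\<forall>C\<in>?I. A \<subseteq> C \<longrightarrow> A = C"
    using finite_has_maximal2[of ?I B] by auto
  have "\<exists>a\<in>A. (v, a) \<in> parcs G" if v: "v \<in> pverts G" "v \<notin> A" for v
  proof (rule ccontr)
    assume "\<not> ?thesis"
    then have "\<forall>a\<in>A. (v, a) \<notin> parcs G \<and> (a, v) \<notin> parcs G"
      using arcs_symmetric by blast
    moreover have "(v, v) \<notin> parcs G" using no_loops' by blast
    ultimately have "insert v A \<in> ?I"
      using A(1) v(1) by simp
    with max v show False by blast
  qed
  with A have "maximal_independent_set G A"
    by (auto simp: maximal_independent_set_def)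
  with A that show ?thesis by blast
qed

lemma total_dominating_set_independent_Un_neighbours:
  assumes "maximal_independent_set G A" "\<And>a. a \<in> A \<Longrightarrow> (a, n a) \<in> parcs G" "pair_graph G"
  shows "total_dominating_set G (A \<union> n ` A)"
proof -
  interpret pair_graph G by fact
  show ?thesis
    using assms(1,2) unfolding total_dominating_set_def maximal_independent_set_def
    by (blast dest: in_arcsD2)
qed

section \<open>Total domination in lexicographic products\<close>

lemma pverts_lex_product [simp]: "pverts (lex_product G F) = pverts G \<times> pverts F"
  by (simp add: lex_product_def)

lemma parcs_lex_product:
  "((g, f), (g', f')) \<in> parcs (lex_product G F) \<longleftrightarrow>
    g \<in> pverts G \<and> f \<in> pverts F \<and> g' \<in> pverts G \<and> f' \<in> pverts F \<and>
    ((g, g') \<in> parcs G \<or> g = g' \<and> (f, f') \<in> parcs F)"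
  by (auto simp: lex_product_def)

text \<open>Since \<open>F\<close> has no loops, the layer of \<open>f\<close> is a copy of
  \<open>G\<close>. Hence private witnesses lift from \<open>v\<close> to \<open>(v, f)\<close>,
  while neighbours in \<open>G\<close> dominate whole fibres.\<close>

lemma minimal_total_dominating_set_Times_singleton:
  assumes "pair_graph F" "minimal_total_dominating_set G S" "f \<in> pverts F"
  shows "minimal_total_dominating_set (lex_product G F) (S \<times> {f})"
proof -
  interpret F: pair_graph F by fact
  have S: "S \<subseteq> pverts G" and dom: "\<And>v. v \<in> pverts G \<Longrightarrow> \<exists>u\<in>S. (v, u) \<in> parcs G"
    and priv: "\<And>u. u \<in> S \<Longrightarrow> \<exists>v\<in>pverts G. \<forall>w\<in>S. (v, w) \<in> parcs G \<longrightarrow> w = u"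
    using assms(2) by (auto simp: minimal_total_dominating_set_iff_private total_dominating_set_def)
  have "total_dominating_set (lex_product G F) (S \<times> {f})"
    using S dom assms(3) by (fastforce simp: total_dominating_set_def parcs_lex_product)
  moreover have "\<exists>v\<in>pverts (lex_product G F). \<forall>w\<in>S \<times> {f}.
      (v, w) \<in> parcs (lex_product G F) \<longrightarrow> w = (u, f)" if "u \<in> S" for u
  proof -
    from priv[OF that] obtain v where "v \<in> pverts G" "\<forall>w\<in>S. (v, w) \<in> parcs G \<longrightarrow> w = u" by blast
    then show ?thesis
      using assms(3) by (intro bexI[of _ "(v, f)"]) (auto simp: parcs_lex_product dest: F.no_loops')
  qed
  ultimately show ?thesis
    by (auto simp: minimal_total_dominating_set_iff_private)
qed

text \<open>Fibres over \<open>A\<close> are dominated from within by copies of \<open>D\<close>,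
  all others through a neighbour in \<open>A\<close>. Independence of \<open>A\<close> keeps the
  fibres over \<open>A\<close> from dominating each other, so a witness \<open>v\<close> for
  \<open>d\<close> stays private as \<open>(a, v)\<close>.\<close>

lemma minimal_total_dominating_set_independent_Times:
  assumes "maximal_independent_set G A" "minimal_total_dominating_set F D"
  shows "minimal_total_dominating_set (lex_product G F) (A \<times> D)"
proof -
  have A: "A \<subseteq> pverts G" "\<And>a b. a \<in> A \<Longrightarrow> b \<in> A \<Longrightarrow> (a, b) \<notin> parcs G"
    "\<And>v. v \<in> pverts G \<Longrightarrow> v \<notin> A \<Longrightarrow> \<exists>a\<in>A. (v, a) \<in> parcs G"
    using assms(1) by (auto simp: maximal_independent_set_def)
  have D: "D \<subseteq> pverts F" and dom: "\<And>v. v \<in> pverts F \<Longrightarrow> \<exists>u\<in>D. (v, u) \<in> parcs F"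
    and priv: "\<And>u. u \<in> D \<Longrightarrow> \<exists>v\<in>pverts F. \<forall>w\<in>D. (v, w) \<in> parcs F \<longrightarrow> w = u"
    using assms(2) by (auto simp: minimal_total_dominating_set_iff_private total_dominating_set_def)
  have "\<exists>u\<in>A \<times> D. ((g, f), u) \<in> parcs (lex_product G F)"
    if gf: "g \<in> pverts G" "f \<in> pverts F" for g f
  proof -
    obtain d where d: "d \<in> D" "(f, d) \<in> parcs F" using dom gf by blast
    show ?thesis
    proof (cases "g \<in> A")
      case True
      with d gf D show ?thesis
        by (intro bexI[of _ "(g, d)"]) (auto simp: parcs_lex_product)
    next
      case False
      with A gf obtain a where "a \<in> A" "(g, a) \<in> parcs G" by blast
      with d gf D A(1) show ?thesis
        by (intro bexI[of _ "(a, d)"]) (auto simp: parcs_lex_product)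
    qed
  qed
  then have "total_dominating_set (lex_product G F) (A \<times> D)"
    using A(1) D by (auto simp: total_dominating_set_def)
  moreover have "\<exists>v\<in>pverts (lex_product G F). \<forall>w\<in>A \<times> D.
      (v, w) \<in> parcs (lex_product G F) \<longrightarrow> w = (a, d)" if "a \<in> A" "d \<in> D" for a d
  proof -
    from priv[OF that(2)] obtain v where "v \<in> pverts F" "\<forall>w\<in>D. (v, w) \<in> parcs F \<longrightarrow> w = d" by blast
    then show ?thesis
      using that A by (intro bexI[of _ "(a, v)"]) (auto simp: parcs_lex_product)
  qed
  ultimately show ?thesis
    by (auto simp: minimal_total_dominating_set_iff_private)
qed

lemma minimal_total_dominating_set_card_ge_2:
  assumes "pair_graph H" "pverts H \<noteq> {}" "minimal_total_dominating_set H S"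
  shows "card S \<ge> 2"
proof -
  interpret pair_graph H by fact
  have S: "S \<subseteq> pverts H" and dom: "\<And>v. v \<in> pverts H \<Longrightarrow> \<exists>u\<in>S. (v, u) \<in> parcs H"
    using assms(3) by (auto simp: minimal_total_dominating_set_def total_dominating_set_def)
  from assms(2) dom obtain u where u: "u \<in> S" by blast
  with S dom obtain w where w: "w \<in> S" "(u, w) \<in> parcs H" by blast
  then have "u \<noteq> w" using no_loops' by blast
  moreover have "finite S" using S pair_finite_verts finite_subset by blast
  ultimately show ?thesis
    using u w card_mono[of S "{u, w}"] by simp
qed

lemma lex_product_complete_card_eq_2:
  fixes G :: "'a pair_pre_digraph"
  assumes "card (pverts G) \<ge> 2" "complete_digraph (card (pverts G)) G"
    and F: "\<And>D. minimal_total_dominating_set F D \<Longrightarrow> card D = 2" and "pverts F \<noteq> {}"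
    and S: "minimal_total_dominating_set (lex_product G F) S"
  shows "card S = 2"
proof -
  have arcs: "(u, v) \<in> parcs G \<longleftrightarrow> u \<in> pverts G \<and> v \<in> pverts G \<and> u \<noteq> v" for u v
    using assms(2) by (auto simp: complete_digraph_pair_def)
  have Ssub: "S \<subseteq> pverts G \<times> pverts F"
    and Sdom: "\<And>v. v \<in> pverts G \<times> pverts F \<Longrightarrow> \<exists>u\<in>S. (v, u) \<in> parcs (lex_product G F)"
    using S by (auto simp: minimal_total_dominating_set_def total_dominating_set_def)
  show ?thesis
  proof (cases "\<exists>x\<in>S. \<exists>y\<in>S. fst x \<noteq> fst y")
    case True
    then obtain x y where xy: "x \<in> S" "y \<in> S" "fst x \<noteq> fst y" by blast
    \<comment> \<open>By completeness, \<open>x\<close> dominates every fibre except its own, and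
      \<open>y\<close> dominates that one.\<close>
    have "total_dominating_set (lex_product G F) {x, y}"
      using xy Ssub
      by (cases x; cases y) (auto simp: total_dominating_set_def parcs_lex_product arcs)
    then have "{x, y} = S"
      using xy by (intro minimal_total_dominating_set_eqI[OF S]) simp_all
    moreover have "x \<noteq> y" using xy by blast
    ultimately show ?thesis by (metis card_2_iff)
  next
    case False
    have "pverts G \<noteq> {}" using assms(1) by auto
    with assms(4) Sdom obtain x where x: "x \<in> S" by blast
    define g D where "g = fst x" and "D = snd ` S"
    have g: "g \<in> pverts G" using x Ssub by (auto simp: g_def)
    have fst_eq: "a = g" if "(a, b) \<in> S" for a b
      using False x that by (metis fst_conv g_def)
    have SD: "S = {g} \<times> D"
    proof (rule set_eqI, rule iffI)
      fix y assume "y \<in> S"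
      then show "y \<in> {g} \<times> D" using fst_eq by (cases y) (auto simp: D_def rev_image_eqI)
    next
      fix y assume "y \<in> {g} \<times> D"
      then obtain a b where "y = (g, b)" "(a, b) \<in> S" by (auto simp: D_def)
      then show "y \<in> S" using fst_eq by blast
    qed
    \<comment> \<open>\<open>E\<close> dominates the fibre over \<open>g\<close>; any single element
      of \<open>{g} \<times> E\<close> dominates all other fibres.\<close>
    have lift: "total_dominating_set (lex_product G F) ({g} \<times> E)" if E: "total_dominating_set F E" for E
    proof -
      obtain e where "e \<in> E" using E assms(4) by (auto simp: total_dominating_set_def)
      with E g show ?thesis
        unfolding total_dominating_set_def
        by (auto simp: parcs_lex_product arcs) blast
    qed
    have "total_dominating_set F D"
      unfolding total_dominating_set_def
    proof (intro conjI ballI)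
      show "D \<subseteq> pverts F" using Ssub by (auto simp: D_def)
      \<comment> \<open>As \<open>g\<close> is not adjacent to itself, \<open>(g, f)\<close> can
        only be dominated through an arc of \<open>F\<close>.\<close>
      fix f assume "f \<in> pverts F"
      with Sdom[of "(g, f)"] g show "\<exists>u\<in>D. (f, u) \<in> parcs F"
        by (auto simp: SD parcs_lex_product arcs)
    qed
    moreover have "\<not> total_dominating_set F E" if E: "E \<subset> D" for E
    proof
      assume "total_dominating_set F E"
      then have "{g} \<times> E = S"
        using E SD by (intro minimal_total_dominating_set_eqI[OF S] lift) auto
      with SD E show False by blast
    qed
    ultimately have "card D = 2"
      by (intro F) (simp add: minimal_total_dominating_set_def)
    then show ?thesis by (simp add: SD card_cartesian_product_singleton)
  qed
qed

lemma lex_product_isolated_fst_image: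
  assumes f0: "f0 \<in> pverts F" "\<And>f. (f0, f) \<notin> parcs F"
    and S: "minimal_total_dominating_set (lex_product G F) S"
  shows "minimal_total_dominating_set G (fst ` S)" and "card (fst ` S) = card S"
proof -
  have Ssub: "S \<subseteq> pverts G \<times> pverts F"
    and Sdom: "\<And>v. v \<in> pverts G \<times> pverts F \<Longrightarrow> \<exists>u\<in>S. (v, u) \<in> parcs (lex_product G F)"
    using S by (auto simp: minimal_total_dominating_set_def total_dominating_set_def)
  \<comment> \<open>Arcs of \<open>G\<close> join whole fibres, so total domination of
    \<open>G\<close> by the projection of \<open>T\<close> lifts to \<open>T\<close>. Both
    conclusions follow from this.\<close>
  have lift: "T = S" if T: "T \<subseteq> S" "total_dominating_set G (fst ` T)" for T
  proof (rule minimal_total_dominating_set_eqI[OF S T(1)])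
    show "total_dominating_set (lex_product G F) T"
      unfolding total_dominating_set_def
    proof (intro conjI ballI)
      show "T \<subseteq> pverts (lex_product G F)" using T Ssub by simp
      fix v assume v: "v \<in> pverts (lex_product G F)"
      then have "fst v \<in> pverts G" by auto
      with T(2) obtain u where u: "u \<in> T" "(fst v, fst u) \<in> parcs G"
        by (auto simp: total_dominating_set_def)
      with T(1) Ssub have "u \<in> pverts G \<times> pverts F" by blast
      with u v show "\<exists>u\<in>T. (v, u) \<in> parcs (lex_product G F)"
        by (intro bexI[of _ u]) (cases u; cases v; auto simp: parcs_lex_product)+
    qed
  qed
  have td: "total_dominating_set G (fst ` S)"
    unfolding total_dominating_set_def
  proof (intro conjI ballI)
    show "fst ` S \<subseteq> pverts G" using Ssub by auto
    \<comment> \<open>Isolation of \<open>f0\<close> forces the neighbour of \<open>(v, f0)\<close>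
      in \<open>S\<close> to come from an arc of \<open>G\<close>.\<close>
    fix v assume "v \<in> pverts G"
    with f0 Sdom[of "(v, f0)"] show "\<exists>u\<in>fst ` S. (v, u) \<in> parcs G"
      by (force simp: parcs_lex_product)
  qed
  have "\<not> total_dominating_set G B" if B: "B \<subset> fst ` S" for B
  proof
    assume "total_dominating_set G B"
    moreover have eq: "fst ` {x \<in> S. fst x \<in> B} = B" using B by auto
    ultimately have "{x \<in> S. fst x \<in> B} = S" by (intro lift) auto
    with eq B show False by auto
  qed
  with td show "minimal_total_dominating_set G (fst ` S)"
    by (simp add: minimal_total_dominating_set_def)
  \<comment> \<open>A transversal: one element of \<open>S\<close> over each projected vertex. By
    \<open>lift\<close> it is all of \<open>S\<close>, so \<open>fst\<close> is injective on
    \<open>S\<close>.\<close>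
  obtain T where T: "T \<subseteq> S" "inj_on fst T" "fst ` T = fst ` S"
    by (metis subset_image_inj order_refl)
  with td lift have "T = S" by metis
  with T show "card (fst ` S) = card S" by (metis card_image)
qed

section \<open>The characterization of well dominated lexicographic products\<close>

lemma well_gamma_t_dominated_lex_productD:
  assumes F: "pair_graph F" "pverts F \<noteq> {}" and G: "pair_graph G"
    and well: "well_gamma_t_dominated (lex_product G F)" and S: "minimal_total_dominating_set G S"
  shows "card S = gamma_t (lex_product G F)"
proof -
  interpret H: pair_graph "lex_product G F" using pair_graph_lex_product[OF G F(1)] .
  obtain f where "f \<in> pverts F" using F(2) by blast
  from well_gamma_t_dominated_card[OF H.pair_finite_verts well
      minimal_total_dominating_set_Times_singleton[OF F(1) S this]]
  show ?thesis by (simp add: card_cartesian_product)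
qed

theorem theorem3p12:
  fixes G :: "'a pair_pre_digraph" and F :: "'b pair_pre_digraph"
  assumes "pair_graph G" and "Digraph_Component.connected G" and "card (pverts G) \<ge> 2"
    and "pair_graph F" and "card (pverts F) \<ge> 2"
  shows "well_gamma_t_dominated (lex_product G F) \<longleftrightarrow>
    (complete_digraph (card (pverts G)) G \<and> well_gamma_t_dominated F \<and> gamma_t F = 2) \<or>
    (well_gamma_t_dominated G \<and> min_degree F = 0)"
proof -
  interpret G: pair_graph G by fact
  interpret F: pair_graph F by fact
  interpret H: pair_graph "lex_product G F"
    using assms pair_graph_lex_product by blast
  let ?k = "gamma_t (lex_product G F)"
  have ne: "pverts G \<noteq> {}" "pverts F \<noteq> {}" using assms(3,5) by auto
  have nb: "\<exists>u. (v, u) \<in> parcs G" if "v \<in> pverts G" for v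
    using connected_imp_neighbour[OF assms(1-3) that] by blast
  then have "total_dominating_set G (pverts G)"
    unfolding total_dominating_set_def by (blast dest: G.in_arcsD2)
  then obtain S\<^sub>G where S\<^sub>G: "minimal_total_dominating_set G S\<^sub>G"
    using ex_minimal_total_dominating_subset[OF G.pair_finite_verts] by blast
  have exH: "\<exists>S. minimal_total_dominating_set (lex_product G F) S"
    using minimal_total_dominating_set_Times_singleton[OF assms(4) S\<^sub>G] ne by blast
  show ?thesis
  proof (intro iffI; (elim disjE conjE)?)
    assume well: "well_gamma_t_dominated (lex_product G F)"
    note cardG = well_gamma_t_dominated_lex_productD[OF assms(4) ne(2) assms(1) well]
    note cardH = well_gamma_t_dominated_card[OF H.pair_finite_verts well]
    show "(complete_digraph (card (pverts G)) G \<and> well_gamma_t_dominated F \<and> gamma_t F = 2) \<or>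
      (well_gamma_t_dominated G \<and> min_degree F = 0)"
    proof (cases "min_degree F = 0")
      case True
      then show ?thesis
        using cardG S\<^sub>G by (auto simp: well_gamma_t_dominated_iff)
    next
      case False
      then have "\<exists>u. (v, u) \<in> parcs F" if "v \<in> pverts F" for v
        using min_degree_eq_0_iff[OF assms(4) ne(2)] that by simp
      then have "total_dominating_set F (pverts F)"
        unfolding total_dominating_set_def by (blast dest: F.in_arcsD2)
      then obtain D\<^sub>F where D\<^sub>F: "minimal_total_dominating_set F D\<^sub>F"
        using ex_minimal_total_dominating_subset[OF F.pair_finite_verts] by blast
      have prod: "card A * card D = ?k"
        if "maximal_independent_set G A" "minimal_total_dominating_set F D" for A D
        using cardH[OF minimal_total_dominating_set_independent_Times[OF that]]
        by (simp add: card_cartesian_product)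
      \<comment> \<open>All minimal total dominating sets of \<open>G\<close> have \<open>?k\<close>
        elements, so \<open>?k\<close> bounds from below the size of any total dominating set of
        \<open>G\<close>, in particular of \<open>A\<close> together with the chosen
        neighbours.\<close>
      have upper: "?k \<le> card A + card (n ` A)"
        if A: "maximal_independent_set G A" and n: "\<And>a. a \<in> A \<Longrightarrow> (a, n a) \<in> parcs G" for A n
      proof -
        have fin: "finite A"
          using A G.pair_finite_verts finite_subset unfolding maximal_independent_set_def by blast
        then have "finite (A \<union> n ` A)" by simp
        from ex_minimal_total_dominating_subset[OF this
            total_dominating_set_independent_Un_neighbours[OF A n assms(1)]]
        obtain T where T: "T \<subseteq> A \<union> n ` A" "minimal_total_dominating_set G T" by blast
        have "?k = card T" using cardG[OF T(2)] by simp
        also have "\<dots> \<le> card (A \<union> n ` A)" using T(1) fin by (intro card_mono) simp_all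
        also have "\<dots> \<le> card A + card (n ` A)" by (rule card_Un_le)
        finally show ?thesis .
      qed
      obtain n where n: "\<And>v. v \<in> pverts G \<Longrightarrow> (v, n v) \<in> parcs G"
        using nb by metis
      have D2: "card D \<ge> 2" if "minimal_total_dominating_set F D" for D
        using minimal_total_dominating_set_card_ge_2[OF assms(4) ne(2) that] .
      obtain A where A: "maximal_independent_set G A"
        using ex_maximal_independent_superset[OF assms(1), of "{}"] by auto
      then have A': "A \<subseteq> pverts G" "finite A" "A \<noteq> {}"
        using ne G.pair_finite_verts finite_subset unfolding maximal_independent_set_def by blast+
      have card2: "card D = 2" if D: "minimal_total_dominating_set F D" for D
      proof -
        have "card A * card D \<le> card A + card (n ` A)"
          using upper[OF A] n A' prod[OF A D] by (metis subsetD)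
        also have "\<dots> \<le> card A * 2" using card_image_le[OF A'(2), of n] by simp
        finally have "card D \<le> 2" using A' by (simp add: card_gt_0_iff)
        with D2[OF D] show ?thesis by simp
      qed
      then have "well_gamma_t_dominated F"
        using D\<^sub>F by (auto simp: well_gamma_t_dominated_iff)
      moreover from this have "gamma_t F = 2"
        using card2[OF D\<^sub>F] well_gamma_t_dominated_card[OF F.pair_finite_verts _ D\<^sub>F] by simp
      moreover have "complete_digraph (card (pverts G)) G"
      proof (rule ccontr)
        assume "\<not> ?thesis"
        then obtain u v w where uvw: "(u, v) \<in> parcs G" "(v, w) \<in> parcs G" "u \<noteq> w" "(u, w) \<notin> parcs G"
          using connected_not_complete_imp_induced_path[OF assms(1,2)] by blast
        have wv: "(w, v) \<in> parcs G" and wu: "(w, u) \<notin> parcs G"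
          using uvw G.arcs_symmetric by blast+
        have "\<forall>a\<in>{u, w}. \<forall>b\<in>{u, w}. (a, b) \<notin> parcs G"
          using uvw wu by (auto dest: G.no_loops')
        moreover have "{u, w} \<subseteq> pverts G"
          using uvw by (auto dest: G.in_arcsD1 G.in_arcsD2)
        ultimately obtain B where B: "{u, w} \<subseteq> B" "maximal_independent_set G B"
          using ex_maximal_independent_superset[OF assms(1)] by metis
        then have B': "B \<subseteq> pverts G" "finite B"
          using G.pair_finite_verts finite_subset unfolding maximal_independent_set_def by blast+
        \<comment> \<open>Redirects \<open>u\<close> and \<open>w\<close> to their common neighbour
          \<open>v\<close>. Then \<open>?m\<close> is not injective on \<open>B\<close>, so its
          image has fewer than \<open>card B\<close> elements, whereas
          \<open>?k = 2 * card B\<close> and \<open>upper\<close> require at least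
          \<open>card B\<close>.\<close>
        let ?m = "n(u := v, w := v)"
        have "card B * 2 \<le> card B + card (?m ` B)"
          using upper[OF B(2), of ?m] n B' uvw wv prod[OF B(2) D\<^sub>F] card2[OF D\<^sub>F]
          by (auto simp: subset_iff)
        moreover have "?m ` B = ?m ` (B - {u})"
          using B(1) uvw(3) by (auto simp: image_iff)
        then have "card (?m ` B) \<le> card (B - {u})"
          using B'(2) by (metis card_image_le finite_Diff)
        moreover have "card (B - {u}) < card B"
          using B B' by (intro psubset_card_mono) auto
        ultimately show False by linarith
      qed
      ultimately show ?thesis by blast
    qed
  next
    assume "complete_digraph (card (pverts G)) G" "well_gamma_t_dominated F" "gamma_t F = 2"
    then have "card S = 2" if "minimal_total_dominating_set (lex_product G F) S" for S
      using lex_product_complete_card_eq_2[OF assms(3) _ _ ne(2) that]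
        well_gamma_t_dominated_card[OF F.pair_finite_verts] by metis
    with exH show "well_gamma_t_dominated (lex_product G F)"
      by (simp add: well_gamma_t_dominated_iff[OF H.pair_finite_verts])
  next
    assume wellG: "well_gamma_t_dominated G" and "min_degree F = 0"
    then obtain f0 where f0: "f0 \<in> pverts F" "\<And>f. (f0, f) \<notin> parcs F"
      using min_degree_eq_0_iff[OF assms(4) ne(2)] by blast
    have "card S = gamma_t G" if "minimal_total_dominating_set (lex_product G F) S" for S
      using lex_product_isolated_fst_image[OF f0 that]
        well_gamma_t_dominated_card[OF G.pair_finite_verts wellG] by metis
    with exH show "well_gamma_t_dominated (lex_product G F)"
      by (simp add: well_gamma_t_dominated_iff[OF H.pair_finite_verts])
  qed
qed

end
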